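(* Every strongly local node query is expressed by a key-invariant LocalSum GNN (with arbitrary real-valued combination functions).
   Context: Fix a finite set $\Pi=\{p_1,\dots,p_n\}$ of propositions. A graph is $G=(V,E,\mathrm{lab})$ with $V$ finite, $E\subseteq V\times V$ irreflexive and symmetric, $\mathrm{lab}:V\to\{0,1\}^n$; a pointed graph $G^u$ has distinguished node $u$; a node query is an isomorphism-closed class of pointed graphs. For $r\ge0$, $G^u{\upharpoonright}r$ is the subgraph of $G$ induced by the nodes at distance at most $r$ from $u$, pointed at $u$. A node query $\mathcal{Q}$ is strongly local if there is $r\ge0$ such that for all pointed graphs $G^u$: $G^u\in\mathcal{Q}$ iff $G^u{\upharpoonright}r\in\mathcal{Q}$. A keyed extension adds an injective $\mathrm{key}:V\to\mathbb{R}$. A GNN is a sequence of layers $(\mathrm{agg}_i,\mathrm{com}_i)_{i=1}^\ell$ with arbitrary $\mathrm{com}_i:\mathbb{R}^{2D_i}\to\mathbb{R}^{D_{i+1}}$, $D_1=n+1$, $D_{\ell+1}=1$; on a keyed graph the initial embedding is $\mathrm{lab}(v)\oplus(\mathrm{key}(v))$, each layer computes $\mathrm{emb}'(u)=\mathrm{com}_i(\mathrm{emb}(u),\mathrm{agg}_i(\{\!\{\mathrm{emb}(v)\mid(u,v)\in E\}\!\}))$, output is the final value at the distinguished node. LocalSum: each $\mathrm{agg}_i$ is coordinate-wise sum. Accept iff output $>0$; key-invariant if for every pointed graph all or none of its keyed extensions are accepted; then it expresses the query of pointed graphs whose keyed extensions are accepted. *)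

theory Defs
  imports Complex_Main "HOL-Library.Multiset" "HOL-Library.Extended_Nat"
begin

text \<open>
  Vectors in \<open>\<real>\<^sup>d\<close> are real lists of length \<open>d\<close>, since the dimensions vary from layer to layer.
  The values of \<open>lab\<close> outside \<open>verts\<close> carry no meaning.
\<close>

record 'v lgraph =
  verts :: "'v set"
  edges :: "('v \<times> 'v) set"
  lab :: "'v \<Rightarrow> real list"

definition lgraph :: "nat \<Rightarrow> 'v lgraph \<Rightarrow> bool" where
  "lgraph n G \<longleftrightarrow>
     finite (verts G) \<and> edges G \<subseteq> verts G \<times> verts G \<and> irrefl (edges G) \<and> sym (edges G) \<and>
     (\<forall>v \<in> verts G. length (lab G v) = n \<and> set (lab G v) \<subseteq> {0, 1})"

definition pointed_graphs :: "nat \<Rightarrow> ('v lgraph \<times> 'v) set" where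
  "pointed_graphs n = {(G, u). lgraph n G \<and> u \<in> verts G}"

definition pointed_iso :: "('v \<Rightarrow> 'w) \<Rightarrow> 'v lgraph \<times> 'v \<Rightarrow> 'w lgraph \<times> 'w \<Rightarrow> bool" where
  "pointed_iso f = (\<lambda>(G, u) (H, w).
     bij_betw f (verts G) (verts H) \<and>
     (\<forall>x \<in> verts G. \<forall>y \<in> verts G. (x, y) \<in> edges G \<longleftrightarrow> (f x, f y) \<in> edges H) \<and>
     (\<forall>x \<in> verts G. lab H (f x) = lab G x) \<and>
     f u = w)"

text \<open>
  Queries are classes of pointed graphs whose vertices come from an arbitrary type \<open>'v\<close>. Every
  finite graph has an isomorphic copy over any infinite \<open>'v\<close>, so that, by closure under isomorphism,
  queries over such a type are queries over all finite graphs.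
\<close>

definition node_query :: "nat \<Rightarrow> ('v lgraph \<times> 'v) set \<Rightarrow> bool" where
  "node_query n Q \<longleftrightarrow>
     Q \<subseteq> pointed_graphs n \<and>
     (\<forall>P \<in> Q. \<forall>P' \<in> pointed_graphs n. (\<exists>f. pointed_iso f P P') \<longrightarrow> P' \<in> Q)"

definition gdist :: "'v lgraph \<Rightarrow> 'v \<Rightarrow> 'v \<Rightarrow> enat" where
  "gdist G u v = (INF k \<in> {k. (u, v) \<in> edges G ^^ k}. enat k)"

definition induced :: "'v lgraph \<Rightarrow> 'v set \<Rightarrow> 'v lgraph" where
  "induced G W = \<lparr>verts = W, edges = edges G \<inter> W \<times> W, lab = lab G\<rparr>"

definition neighbourhood :: "'v lgraph \<Rightarrow> 'v \<Rightarrow> nat \<Rightarrow> 'v lgraph" where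
  "neighbourhood G u r = induced G {v \<in> verts G. gdist G u v \<le> enat r}"

definition strongly_local :: "nat \<Rightarrow> ('v lgraph \<times> 'v) set \<Rightarrow> bool" where
  "strongly_local n Q \<longleftrightarrow>
     (\<exists>r. \<forall>(G, u) \<in> pointed_graphs n. (G, u) \<in> Q \<longleftrightarrow> (neighbourhood G u r, u) \<in> Q)"

record layer =
  agg :: "real list multiset \<Rightarrow> real list"
  com :: "real list \<Rightarrow> real list"

text \<open>
  Layers are numbered from \<open>0\<close>, so layer \<open>i\<close> maps vectors of dimension \<open>dims N i\<close> to vectors of
  dimension \<open>dims N (Suc i)\<close>. Combination functions take the concatenation of their two arguments.
\<close>

record gnn =
  dims :: "nat \<Rightarrow> nat"
  layers :: "layer list"

definition gnn :: "nat \<Rightarrow> gnn \<Rightarrow> bool" where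
  "gnn n N \<longleftrightarrow>
     dims N 0 = n + 1 \<and> dims N (length (layers N)) = 1 \<and>
     (\<forall>i < length (layers N).
        (\<forall>M. (\<forall>x \<in># M. length x = dims N i) \<longrightarrow> length (agg (layers N ! i) M) = dims N i) \<and>
        (\<forall>x. length x = 2 * dims N i \<longrightarrow> length (com (layers N ! i) x) = dims N (Suc i)))"

definition vec_sum :: "nat \<Rightarrow> real list multiset \<Rightarrow> real list" where
  "vec_sum d M = map (\<lambda>j. \<Sum>x \<in># M. x ! j) [0..<d]"

definition local_sum :: "gnn \<Rightarrow> bool" where
  "local_sum N \<longleftrightarrow>
     (\<forall>i < length (layers N). \<forall>M. (\<forall>x \<in># M. length x = dims N i) \<longrightarrow>
        agg (layers N ! i) M = vec_sum (dims N i) M)"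

definition keyed_extension :: "'v lgraph \<Rightarrow> ('v \<Rightarrow> real) \<Rightarrow> bool" where
  "keyed_extension G key \<longleftrightarrow> inj_on key (verts G)"

definition initial_emb :: "'v lgraph \<Rightarrow> ('v \<Rightarrow> real) \<Rightarrow> 'v \<Rightarrow> real list" where
  "initial_emb G key v = lab G v @ [key v]"

definition apply_layer :: "'v lgraph \<Rightarrow> layer \<Rightarrow> ('v \<Rightarrow> real list) \<Rightarrow> 'v \<Rightarrow> real list" where
  "apply_layer G L emb u =
     com L (emb u @ agg L (image_mset emb (mset_set {v. (u, v) \<in> edges G})))"

definition gnn_output :: "gnn \<Rightarrow> 'v lgraph \<Rightarrow> ('v \<Rightarrow> real) \<Rightarrow> 'v \<Rightarrow> real" where
  "gnn_output N G key u = hd (fold (apply_layer G) (layers N) (initial_emb G key) u)"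

definition accepts :: "gnn \<Rightarrow> 'v lgraph \<Rightarrow> ('v \<Rightarrow> real) \<Rightarrow> 'v \<Rightarrow> bool" where
  "accepts N G key u \<longleftrightarrow> gnn_output N G key u > 0"

definition key_invariant :: "'v itself \<Rightarrow> nat \<Rightarrow> gnn \<Rightarrow> bool" where
  "key_invariant _ n N \<longleftrightarrow>
     (\<forall>(G :: 'v lgraph, u) \<in> pointed_graphs n.
        (\<forall>key. keyed_extension G key \<longrightarrow> accepts N G key u) \<or>
        (\<forall>key. keyed_extension G key \<longrightarrow> \<not> accepts N G key u))"

definition expressed_query :: "nat \<Rightarrow> gnn \<Rightarrow> ('v lgraph \<times> 'v) set" where
  "expressed_query n N =
     {(G, u) \<in> pointed_graphs n. \<forall>key. keyed_extension G key \<longrightarrow> accepts N G key u}"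

end

theory Submission imports Defs "HOL-Library.Countable" begin

text \<open>
  There is a map \<open>enc\<close> from vectors to reals for which the sum of \<open>enc\<close> over a finite set of vectors
  determines the set: attach to the vectors an almost disjoint family of infinite sets of naturals,
  and let \<open>enc\<close> sum the sparse series \<open>1 / 2 ^ k\<^sup>2\<close> over the set attached to a vector. Since keys
  make all embeddings in a graph distinct, summation of encoded embeddings loses no information, and
  sum aggregation simulates colour refinement. On keyed graphs, the colour of \<open>u\<close> after \<open>r + 1\<close>
  rounds determines the neighbourhood of \<open>u\<close> of radius \<open>r\<close> up to isomorphism (the additional round
  detects the edges between nodes at distance \<open>r\<close>), and an arbitrary combination function can then
  decide the query.
\<close>

section \<open>An encoding of vectors with injective finite sums\<close>

text \<open>As \<open>(j + Suc K)\<^sup>2\<close> is at least \<open>K\<^sup>2 + K + Suc j\<close>,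
  the geometric series \<open>?g\<close> dominates the tail.\<close>

lemma sparse_series_tail:
  fixes d :: "nat \<Rightarrow> int"
  assumes bound: "\<And>k. \<bar>d k\<bar> \<le> M"
  shows "summable (\<lambda>j. real_of_int (d (j + Suc K)) / 2 ^ (j + Suc K)\<^sup>2)"
    and "2 ^ K\<^sup>2 * \<bar>\<Sum>j. real_of_int (d (j + Suc K)) / 2 ^ (j + Suc K)\<^sup>2\<bar> \<le> real_of_int M / 2 ^ K"
proof -
  let ?f = "\<lambda>j. real_of_int (d (j + Suc K)) / 2 ^ (j + Suc K)\<^sup>2"
  let ?g = "\<lambda>j. real_of_int M / 2 ^ (K\<^sup>2 + K) * (1 / 2) ^ Suc j"
  have le: "norm (?f j) \<le> ?g j" for j
  proof -
    have "K\<^sup>2 + K + Suc j \<le> (j + Suc K)\<^sup>2"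
      by (simp add: power2_eq_square algebra_simps)
    then have pow: "(2::real) ^ (K\<^sup>2 + K + Suc j) \<le> 2 ^ (j + Suc K)\<^sup>2"
      by (intro power_increasing) auto
    have "norm (?f j) = real_of_int \<bar>d (j + Suc K)\<bar> / 2 ^ (j + Suc K)\<^sup>2"
      by simp
    also have "\<dots> \<le> real_of_int M / 2 ^ (K\<^sup>2 + K + Suc j)"
      using bound[of "j + Suc K"] pow by (intro frac_le) auto
    also have "\<dots> = ?g j"
      by (simp add: power_add power_divide)
    finally show ?thesis .
  qed
  have sg: "?g sums (real_of_int M / 2 ^ (K\<^sup>2 + K))"
    using sums_mult[OF power_half_series, of "real_of_int M / 2 ^ (K\<^sup>2 + K)"] by simp
  show sf: "summable ?f"
    by (rule summable_comparison_test'[OF sums_summable[OF sg] le])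
  have "norm (\<Sum>j. ?f j) \<le> (\<Sum>j. ?g j)"
    by (rule norm_suminf_le[OF le sums_summable[OF sg]])
  then have "\<bar>\<Sum>j. ?f j\<bar> \<le> real_of_int M / 2 ^ (K\<^sup>2 + K)"
    using sums_unique[OF sg] by simp
  then show "2 ^ K\<^sup>2 * \<bar>\<Sum>j. ?f j\<bar> \<le> real_of_int M / 2 ^ K"
    by (simp add: power_add field_simps)
qed

lemma sparse_series_summable:
  fixes d :: "nat \<Rightarrow> int"
  assumes "\<And>k. \<bar>d k\<bar> \<le> M"
  shows "summable (\<lambda>k. real_of_int (d k) / 2 ^ k\<^sup>2)"
  using sparse_series_tail(1)[of d M 0, OF assms]
  by (subst (asm) summable_iff_shift[of "\<lambda>k. real_of_int (d k) / 2 ^ k\<^sup>2"])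

text \<open>A late partial sum is minus a tail and turns out to be 0, hence so is the difference of
  two consecutive ones, a late term. Early terms may cancel without being 0, as in 1 - 2 / 2, so
  only finiteness follows.\<close>

lemma sparse_series_eq_0:
  fixes d :: "nat \<Rightarrow> int"
  assumes bound: "\<And>k. \<bar>d k\<bar> \<le> M" and zero: "(\<Sum>k. real_of_int (d k) / 2 ^ k\<^sup>2) = 0"
  shows "finite {k. d k \<noteq> 0}"
proof -
  let ?f = "\<lambda>k. real_of_int (d k) / 2 ^ k\<^sup>2"
  \<comment> \<open>From \<open>K0\<close> on, the scaled tail is below 1.\<close>
  obtain K0 where K0: "real_of_int M < 2 ^ K0"
    using real_arch_pow[of 2 "real_of_int M"] by auto
  \<comment> \<open>Multiplied by \<open>2 ^ K\<^sup>2\<close>, the partial sum is an integer and the tail is smaller than 1.\<close>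
  have partial: "(\<Sum>k<Suc K. ?f k) = 0" if "K0 \<le> K" for K
  proof -
    define z where "z = (\<Sum>k<Suc K. d k * 2 ^ (K\<^sup>2 - k\<^sup>2))"
    have "2 ^ K\<^sup>2 * ?f k = real_of_int (d k * 2 ^ (K\<^sup>2 - k\<^sup>2))" if "k < Suc K" for k
    proof -
      have "k\<^sup>2 \<le> K\<^sup>2"
        using that by (intro power_mono) auto
      then have "(2::real) ^ K\<^sup>2 = 2 ^ (K\<^sup>2 - k\<^sup>2) * 2 ^ k\<^sup>2"
        by (simp flip: power_add)
      then show ?thesis
        by simp
    qed
    then have z: "real_of_int z = 2 ^ K\<^sup>2 * (\<Sum>k<Suc K. ?f k)"
      unfolding z_def of_int_sum sum_distrib_left by (intro sum.cong) auto
    have "(\<Sum>k. ?f k) = (\<Sum>j. ?f (j + Suc K)) + (\<Sum>k<Suc K. ?f k)"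
      by (rule suminf_split_initial_segment[OF sparse_series_summable[of d M, OF bound]])
    then have "\<bar>\<Sum>k<Suc K. ?f k\<bar> = \<bar>\<Sum>j. ?f (j + Suc K)\<bar>"
      using zero by linarith
    then have "\<bar>real_of_int z\<bar> = 2 ^ K\<^sup>2 * \<bar>\<Sum>j. ?f (j + Suc K)\<bar>"
      unfolding z abs_mult by simp
    also have "\<dots> \<le> real_of_int M / 2 ^ K"
      by (rule sparse_series_tail(2)[of d M, OF bound])
    also have "\<dots> < 1"
    proof -
      have "(2::real) ^ K0 \<le> 2 ^ K"
        using that by (intro power_increasing) auto
      with K0 have "real_of_int M < 2 ^ K"
        by linarith
      then show ?thesis
        by (subst divide_less_eq_1_pos) auto
    qed
    finally have "z = 0"
      by linarith
    then show ?thesis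
      using z by simp
  qed
  have "d k = 0" if k: "Suc K0 \<le> k" for k
  proof -
    obtain K where K: "k = Suc K" "K0 \<le> K"
      using k by (cases k) auto
    have "?f k = (\<Sum>i<Suc k. ?f i) - (\<Sum>i<Suc K. ?f i)"
      unfolding K(1) by simp
    also have "\<dots> = 0"
      using partial[of K] partial[of k] K by simp
    finally show ?thesis
      by simp
  qed
  then have "{k. d k \<noteq> 0} \<subseteq> {..<Suc K0}"
    by (auto simp: not_less[symmetric])
  then show ?thesis
    by (rule finite_subset) simp
qed

section \<open>An almost disjoint family indexed by vectors\<close>

text \<open>Each element codes an approximation of \<open>xs\<close> with common denominator
  \<open>m\<close>. Recording \<open>m\<close> keeps the set infinite even for \<open>[]\<close> or
  a zero vector.\<close>

definition approximations :: "real list \<Rightarrow> nat set" where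
  "approximations xs = range (\<lambda>m. to_nat (m, map (\<lambda>x. \<lfloor>real m * x\<rfloor>) xs))"

text \<open>The binary digits sit at square positions, whose growing gaps absorb the carries of a
  finite sum from some position on.\<close>

definition enc :: "real list \<Rightarrow> real" where
  "enc xs = (\<Sum>k. of_bool (k \<in> approximations xs) / 2 ^ k\<^sup>2)"

lemma infinite_approximations: "infinite (approximations xs)"
  unfolding approximations_def by (rule range_inj_infinite) (auto intro: injI)

text \<open>Equal floors put \<open>real m * x\<close> and \<open>real m * y\<close> less than 1
  apart, which fails for all large \<open>m\<close> if \<open>x\<close> and \<open>y\<close>
  differ.\<close>

lemma eq_if_floor_mult_eq:
  fixes x y :: real
  assumes inf: "infinite {m. \<lfloor>real m * x\<rfloor> = \<lfloor>real m * y\<rfloor>}"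
  shows "x = y"
proof (rule ccontr)
  assume "x \<noteq> y"
  then obtain N where N: "1 < real N * \<bar>x - y\<bar>"
    using reals_Archimedean3[of "\<bar>x - y\<bar>"] by auto
  obtain m where m: "N < m" "\<lfloor>real m * x\<rfloor> = \<lfloor>real m * y\<rfloor>"
    using inf unfolding infinite_nat_iff_unbounded by auto
  have "real m * \<bar>x - y\<bar> = \<bar>real m * x - real m * y\<bar>"
    by (simp add: abs_mult flip: right_diff_distrib)
  also have "\<dots> < 1"
    using m(2) by linarith
  finally have "real m * \<bar>x - y\<bar> < 1" .
  moreover have "real N * \<bar>x - y\<bar> \<le> real m * \<bar>x - y\<bar>"
    using m(1) by (intro mult_right_mono) auto
  ultimately show False
    using N by simp
qed

text \<open>A common element determines \<open>m\<close>, so both vectors have the same floors at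
  that \<open>m\<close>; infinitely many such \<open>m\<close> would make all coordinates
  equal.\<close>

lemma approximations_almost_disjoint:
  assumes "xs \<noteq> ys"
  shows "finite (approximations xs \<inter> approximations ys)"
proof -
  let ?a = "\<lambda>m. map (\<lambda>x. \<lfloor>real m * x\<rfloor>)"
  let ?M = "{m. ?a m xs = ?a m ys}"
  have "finite ?M"
  proof (rule ccontr)
    assume inf: "infinite ?M"
    then obtain m where "?a m xs = ?a m ys"
      using not_finite_existsD by auto
    then have len: "length xs = length ys"
      by (rule map_eq_imp_length_eq)
    have "xs ! i = ys ! i" if "i < length xs" for i
    proof (rule eq_if_floor_mult_eq)
      have "?M \<subseteq> {m. \<lfloor>real m * xs ! i\<rfloor> = \<lfloor>real m * ys ! i\<rfloor>}"
        using that len by (auto simp: list_eq_iff_nth_eq)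
      then show "infinite {m. \<lfloor>real m * xs ! i\<rfloor> = \<lfloor>real m * ys ! i\<rfloor>}"
        using inf finite_subset by blast
    qed
    then show False
      using assms len by (auto simp: list_eq_iff_nth_eq)
  qed
  moreover have "approximations xs \<inter> approximations ys \<subseteq> (\<lambda>m. to_nat (m, ?a m xs)) ` ?M"
    by (auto simp: approximations_def)
  ultimately show ?thesis
    using finite_surj by blast
qed

lemma sum_enc:
  assumes "finite A"
  shows "(\<Sum>x\<in>A. enc x) = (\<Sum>k. real (card {x \<in> A. k \<in> approximations x}) / 2 ^ k\<^sup>2)"
proof -
  have summ: "summable (\<lambda>k. of_bool (k \<in> approximations x) / (2::real) ^ k\<^sup>2)" for x
    using sparse_series_summable[of "\<lambda>k. of_bool (k \<in> approximations x)" 1] by simp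
  have "(\<Sum>x\<in>A. enc x) = (\<Sum>k. \<Sum>x\<in>A. of_bool (k \<in> approximations x) / 2 ^ k\<^sup>2)"
    unfolding enc_def by (rule suminf_sum[symmetric]) (rule summ)
  also have "\<dots> = (\<Sum>k. real (card {x \<in> A. k \<in> approximations x}) / 2 ^ k\<^sup>2)"
  proof (rule suminf_cong)
    fix k
    have "(\<Sum>x\<in>A. of_bool (k \<in> approximations x)) = real (card {x \<in> A. k \<in> approximations x})"
      using assms by (simp add: of_bool_def sum.If_cases Int_def)
    then show "(\<Sum>x\<in>A. of_bool (k \<in> approximations x) / 2 ^ k\<^sup>2) =
        real (card {x \<in> A. k \<in> approximations x}) / 2 ^ k\<^sup>2"
      by (simp flip: sum_divide_distrib)
  qed
  finally show ?thesis .
qed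

text \<open>If \<open>x\<close> were in \<open>A\<close> but not in \<open>B\<close>, the digit
  counts would differ at almost all of the infinitely many \<open>k\<close> in
  \<open>approximations x\<close>, while equal sums allow only finitely many differences.\<close>

lemma subset_if_sum_enc_eq:
  assumes fin: "finite A" "finite B" and eq: "(\<Sum>x\<in>A. enc x) = (\<Sum>x\<in>B. enc x)"
  shows "A \<subseteq> B"
proof (rule ccontr)
  assume "\<not> A \<subseteq> B"
  then obtain x where x: "x \<in> A" "x \<notin> B"
    by auto
  let ?c = "\<lambda>A k. card {x \<in> A. k \<in> approximations x}"
  define d where "d k = int (?c A k) - int (?c B k)" for k
  have card_le: "?c A k \<le> card A" "?c B k \<le> card B" for k
    using fin by (auto intro: card_mono)
  have bound: "\<bar>d k\<bar> \<le> int (card A + card B)" for k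
    using card_le[of k] unfolding d_def by linarith
  have summ: "summable (\<lambda>k. real (?c C k) / 2 ^ k\<^sup>2)" if "finite C" for C
    using sparse_series_summable[of "\<lambda>k. int (?c C k)" "int (card C)"] that
    by (simp add: card_mono)
  have "(\<Sum>k. real_of_int (d k) / 2 ^ k\<^sup>2) = (\<Sum>k. real (?c A k) / 2 ^ k\<^sup>2 - real (?c B k) / 2 ^ k\<^sup>2)"
    by (simp add: d_def diff_divide_distrib)
  also have "\<dots> = (\<Sum>x\<in>A. enc x) - (\<Sum>x\<in>B. enc x)"
    unfolding sum_enc[OF fin(1)] sum_enc[OF fin(2)]
    by (rule suminf_diff[symmetric]) (intro summ fin)+
  finally have "finite {k. d k \<noteq> 0}"
    using sparse_series_eq_0[of d, OF bound] eq by simp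
  moreover have "finite (\<Union>y \<in> (A \<union> B) - {x}. approximations x \<inter> approximations y)"
    using fin by (intro finite_UN_I approximations_almost_disjoint) auto
  moreover have "approximations x \<subseteq>
      {k. d k \<noteq> 0} \<union> (\<Union>y \<in> (A \<union> B) - {x}. approximations x \<inter> approximations y)"
  proof
    fix k
    assume k: "k \<in> approximations x"
    show "k \<in> {k. d k \<noteq> 0} \<union> (\<Union>y \<in> (A \<union> B) - {x}. approximations x \<inter> approximations y)"
    proof (cases "\<exists>y \<in> (A \<union> B) - {x}. k \<in> approximations y")
      case False
      \<comment> \<open>Outside the finite overlaps with other vectors, only \<open>x\<close> itself
        is counted at \<open>k\<close>.\<close>
      then have "{x \<in> A. k \<in> approximations x} = {x}" "{x \<in> B. k \<in> approximations x} = {}"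
        using x k by auto
      then have "d k = 1"
        unfolding d_def by (simp only: card.empty) simp
      then show ?thesis
        by simp
    qed (use k in auto)
  qed
  ultimately show False
    using infinite_approximations finite_subset by (metis finite_UnI)
qed

lemma sum_enc_inj:
  assumes "finite A" "finite B" "(\<Sum>x\<in>A. enc x) = (\<Sum>x\<in>B. enc x)"
  shows "A = B"
  using assms by (intro equalityI subset_if_sum_enc_eq) auto

lemma enc_eq_iff [simp]: "enc x = enc y \<longleftrightarrow> x = y"
  using sum_enc_inj[of "{x}" "{y}"] by auto

section \<open>Colour refinement of keyed graphs\<close>

text \<open>The sum of codes stands for the set of neighbour colours. The own colour is kept so that
  each round refines the previous one and the key is never lost.\<close>

primrec colour :: "'v lgraph \<Rightarrow> ('v \<Rightarrow> real) \<Rightarrow> nat \<Rightarrow> 'v \<Rightarrow> real list" where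
  "colour G key 0 v = lab G v @ [key v]"
| "colour G key (Suc i) v =
     [enc (colour G key i v), \<Sum>w | (v, w) \<in> edges G. enc (colour G key i w)]"

lemma colour_eq_mono:
  "colour G key i v = colour H key' i w \<Longrightarrow> j \<le> i \<Longrightarrow> colour G key j v = colour H key' j w"
  by (induction i) (auto simp: le_Suc_eq)

lemma colour_eqD:
  assumes "colour G key i v = colour H key' i w"
  shows "lab G v = lab H w" "key v = key' w"
  using colour_eq_mono[OF assms, of 0] by auto

lemma inj_on_colour: "inj_on key V \<Longrightarrow> inj_on (colour G key i) V"
  by (auto simp: inj_on_def dest: colour_eqD)

lemma lgraph_neighbours:
  assumes "lgraph n G"
  shows "finite {w. (v, w) \<in> edges G}" "{w. (v, w) \<in> edges G} \<subseteq> verts G"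
proof -
  show sub: "{w. (v, w) \<in> edges G} \<subseteq> verts G"
    using assms by (auto simp: lgraph_def)
  show "finite {w. (v, w) \<in> edges G}"
    using finite_subset[OF sub] assms by (auto simp: lgraph_def)
qed

text \<open>Keys separate the neighbours, so each sum runs over a set of colours without repetition,
  and \<open>sum_enc_inj\<close> recovers that set.\<close>

lemma colour_Suc_neighbour:
  assumes G: "lgraph n G" "inj_on key (verts G)" and H: "lgraph n H" "inj_on key' (verts H)"
    and eq: "colour G key (Suc i) v = colour H key' (Suc i) v'" and edge: "(v, w) \<in> edges G"
  obtains w' where "(v', w') \<in> edges H" "colour G key i w = colour H key' i w'"
proof -
  let ?A = "{w. (v, w) \<in> edges G}" and ?B = "{w. (v', w) \<in> edges H}"
  have "inj_on (colour G key i) ?A" "inj_on (colour H key' i) ?B"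
    using inj_on_subset[OF inj_on_colour[OF G(2)] lgraph_neighbours(2)[OF G(1)]]
      inj_on_subset[OF inj_on_colour[OF H(2)] lgraph_neighbours(2)[OF H(1)]] by auto
  then have "sum enc (colour G key i ` ?A) = sum enc (colour H key' i ` ?B)"
    using eq by (simp add: sum.reindex)
  then have "colour G key i ` ?A = colour H key' i ` ?B"
    using lgraph_neighbours(1)[OF G(1)] lgraph_neighbours(1)[OF H(1)]
    by (intro sum_enc_inj) auto
  then show ?thesis
    using edge that by (force simp: set_eq_iff image_iff)
qed

text \<open>Each edge of the walk costs one round.\<close>

lemma colour_walk:
  assumes G: "lgraph n G" "inj_on key (verts G)" and H: "lgraph n H" "inj_on key' (verts H)"
    and eq: "colour G key (i + k) v = colour H key' (i + k) v'" and walk: "(v, w) \<in> edges G ^^ k"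
  obtains w' where "(v', w') \<in> edges H ^^ k" "colour G key i w = colour H key' i w'"
  using eq walk
proof (induction k arbitrary: i w thesis)
  case 0
  then show ?case
    by auto
next
  case (Suc k)
  from Suc.prems(3) obtain x where x: "(v, x) \<in> edges G ^^ k" "(x, w) \<in> edges G"
    by auto
  \<comment> \<open>At \<open>Suc i\<close> the hypothesis leaves a spare round at \<open>x\<close>,
    to be spent on the last edge.\<close>
  obtain x' where x': "(v', x') \<in> edges H ^^ k" "colour G key (Suc i) x = colour H key' (Suc i) x'"
    using Suc.IH[of "Suc i" x] Suc.prems(2) x(1) by auto
  from colour_Suc_neighbour[OF G H x'(2) x(2)] obtain w'
    where "(x', w') \<in> edges H" "colour G key i w = colour H key' i w'" .
  with x' show ?case
    by (intro Suc.prems(1)) auto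
qed

section \<open>Balls and their isomorphism\<close>

lemma gdist_le_iff: "gdist G u v \<le> enat r \<longleftrightarrow> (\<exists>k\<le>r. (u, v) \<in> edges G ^^ k)"
proof
  assume le: "gdist G u v \<le> enat r"
  let ?K = "enat ` {k. (u, v) \<in> edges G ^^ k}"
  have "?K \<noteq> {}"
  proof
    assume "?K = {}"
    then have "gdist G u v = \<infinity>"
      unfolding gdist_def by (simp only: Inf_empty top_enat_def)
    with le show False
      by simp
  qed
  \<comment> \<open>\<open>enat\<close> is well-ordered, so the infimum of a nonempty set is
    attained, here by a walk length.\<close>
  then have "gdist G u v \<in> ?K"
    unfolding gdist_def by (rule wellorder_InfI[OF ex_in_conv[THEN iffD2, THEN someI_ex]])
  with le show "\<exists>k\<le>r. (u, v) \<in> edges G ^^ k"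
    by auto
next
  assume "\<exists>k\<le>r. (u, v) \<in> edges G ^^ k"
  then obtain k where "k \<le> r" "(u, v) \<in> edges G ^^ k"
    by auto
  then show "gdist G u v \<le> enat r"
    unfolding gdist_def by (intro INF_lower2[of k]) auto
qed

lemma verts_neighbourhood:
  "verts (neighbourhood G u r) = {v \<in> verts G. \<exists>k\<le>r. (u, v) \<in> edges G ^^ k}"
  by (simp add: neighbourhood_def induced_def gdist_le_iff)

lemma edges_neighbourhood:
  "edges (neighbourhood G u r) =
    edges G \<inter> verts (neighbourhood G u r) \<times> verts (neighbourhood G u r)"
  by (simp add: neighbourhood_def induced_def)

lemma lab_neighbourhood [simp]: "lab (neighbourhood G u r) = lab G"
  by (simp add: neighbourhood_def induced_def)

lemma neighbourhood_pointed_graph: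
  assumes "(G, u) \<in> pointed_graphs n"
  shows "(neighbourhood G u r, u) \<in> pointed_graphs n"
proof -
  have "(u, u) \<in> edges G ^^ 0"
    by simp
  then have "u \<in> verts (neighbourhood G u r)"
    using assms unfolding verts_neighbourhood pointed_graphs_def by blast
  moreover have "verts (neighbourhood G u r) \<subseteq> verts G"
    by (auto simp: verts_neighbourhood)
  ultimately show ?thesis
    using assms
    by (auto simp: pointed_graphs_def lgraph_def edges_neighbourhood irrefl_def sym_def
        intro: finite_subset)
qed

lemma walk_in_verts:
  assumes "lgraph n G" "u \<in> verts G" "(u, v) \<in> edges G ^^ k"
  shows "v \<in> verts G"
  using assms by (cases k) (auto simp: lgraph_def)

text \<open>Reaching \<open>x\<close> uses at most \<open>r\<close> of the \<open>Suc r\<close>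
  rounds; the one left over serves to compare edges.\<close>

lemma colour_neighbourhood:
  assumes G: "lgraph n G" "inj_on key (verts G)"
    and H: "lgraph n H" "inj_on key' (verts H)" "u' \<in> verts H"
    and eq: "colour G key (Suc r) u = colour H key' (Suc r) u'"
    and x: "x \<in> verts (neighbourhood G u r)"
  obtains x' where "x' \<in> verts (neighbourhood H u' r)" "colour G key 1 x = colour H key' 1 x'"
proof -
  obtain k where k: "k \<le> r" "(u, x) \<in> edges G ^^ k"
    using x by (auto simp: verts_neighbourhood)
  then have "colour G key (1 + k) u = colour H key' (1 + k) u'"
    by (intro colour_eq_mono[OF eq]) simp
  from colour_walk[OF G H(1,2) this k(2)] obtain x'
    where x': "(u', x') \<in> edges H ^^ k" "colour G key 1 x = colour H key' 1 x'" .
  moreover have "x' \<in> verts H"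
    using walk_in_verts[OF H(1,3) x'(1)] .
  ultimately show ?thesis
    using k(1) by (intro that) (auto simp: verts_neighbourhood)
qed

text \<open>Round 1 at \<open>x\<close> reveals the keys of its neighbours, so some neighbour of
  \<open>x'\<close> has the key of \<open>y'\<close> and is \<open>y'\<close> by
  injectivity.\<close>

lemma neighbourhood_edge_transfer:
  assumes G: "lgraph n G" "inj_on key (verts G)" and H: "lgraph n H" "inj_on key' (verts H)"
    and eq: "colour G key 1 x = colour H key' 1 x'" "key y = key' y'"
    and mem: "y' \<in> verts H" and edge: "(x, y) \<in> edges G"
  shows "(x', y') \<in> edges H"
proof -
  from colour_Suc_neighbour[OF G H eq(1)[unfolded One_nat_def] edge] obtain w
    where w: "(x', w) \<in> edges H" "colour G key 0 y = colour H key' 0 w" .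
  then have "key' w = key' y'" "w \<in> verts H"
    using eq(2) H(1) by (auto simp: lgraph_def)
  then show ?thesis
    using w(1) H(2) mem by (auto dest: inj_onD)
qed

text \<open>Equal colours carry equal keys, so nodes are matched by key; agreement of the matched
  nodes in round 1 yields edges and labels.\<close>

lemma pointed_iso_neighbourhood:
  assumes G: "(G, u) \<in> pointed_graphs n" "inj_on key (verts G)"
    and H: "(H, u') \<in> pointed_graphs n" "inj_on key' (verts H)"
    and eq: "colour G key (Suc r) u = colour H key' (Suc r) u'"
  shows "\<exists>f. pointed_iso f (neighbourhood G u r, u) (neighbourhood H u' r, u')"
proof -
  let ?A = "verts (neighbourhood G u r)" and ?B = "verts (neighbourhood H u' r)"
  have lG: "lgraph n G" "u \<in> verts G" and lH: "lgraph n H" "u' \<in> verts H"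
    using G(1) H(1) by (auto simp: pointed_graphs_def)
  have sub: "?A \<subseteq> verts G" "?B \<subseteq> verts H"
    by (auto simp: verts_neighbourhood)
  define f where "f x = inv_into (verts H) key' (key x)" for x
  have f_eq: "f x = x'" if "key x = key' x'" "x' \<in> verts H" for x x'
    using that H(2) by (simp add: f_def inv_into_f_f)
  have f: "f x \<in> ?B \<and> colour G key 1 x = colour H key' 1 (f x)" if x: "x \<in> ?A" for x
  proof -
    from colour_neighbourhood[OF lG(1) G(2) lH(1) H(2) lH(2) eq x] obtain x'
      where x': "x' \<in> ?B" "colour G key 1 x = colour H key' 1 x'" .
    then have "f x = x'"
      using f_eq colour_eqD(2)[OF x'(2)] sub by blast
    then show ?thesis
      using x' by simp
  qed
  have key_f: "key x = key' (f x)" if "x \<in> ?A" for x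
    using f[OF that] by (blast dest: colour_eqD(2))
  have bij: "bij_betw f ?A ?B"
  proof (intro bij_betw_imageI equalityI subsetI)
    show "inj_on f ?A"
    proof (rule inj_onI)
      fix x y
      assume "x \<in> ?A" "y \<in> ?A" "f x = f y"
      then have "key x = key y"
        by (simp add: key_f)
      then show "x = y"
        using G(2) sub(1) \<open>x \<in> ?A\<close> \<open>y \<in> ?A\<close> by (meson inj_onD subsetD)
    qed
  next
    fix y
    assume "y \<in> f ` ?A"
    then show "y \<in> ?B"
      using f by auto
  next
    fix y
    assume y: "y \<in> ?B"
    \<comment> \<open>Surjectivity is the same argument with the two graphs exchanged.\<close>
    from colour_neighbourhood[OF lH(1) H(2) lG(1) G(2) lG(2) eq[symmetric] y] obtain x
      where x: "x \<in> ?A" "colour H key' 1 y = colour G key 1 x" .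
    then have "f x = y"
      using f_eq colour_eqD(2)[OF x(2)] y sub by (metis subsetD)
    then show "y \<in> f ` ?A"
      using x(1) by auto
  qed
  moreover have "(x, y) \<in> edges (neighbourhood G u r) \<longleftrightarrow>
      (f x, f y) \<in> edges (neighbourhood H u' r)" if "x \<in> ?A" "y \<in> ?A" for x y
  proof -
    have "(x, y) \<in> edges G \<Longrightarrow> (f x, f y) \<in> edges H"
      using neighbourhood_edge_transfer[OF lG(1) G(2) lH(1) H(2)] f key_f that sub by blast
    moreover have "(f x, f y) \<in> edges H \<Longrightarrow> (x, y) \<in> edges G"
      using neighbourhood_edge_transfer[OF lH(1) H(2) lG(1) G(2), of "f x" x "f y" y]
        f key_f that sub by force
    ultimately show ?thesis
      using f that unfolding edges_neighbourhood by auto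
  qed
  moreover have "lab H (f x) = lab G x" if "x \<in> ?A" for x
    using colour_eqD(1) f[OF that] by metis
  moreover have "f u = u'"
    using f_eq colour_eqD(2)[OF eq] lH(2) by blast
  ultimately show ?thesis
    by (auto simp: pointed_iso_def)
qed

section \<open>The network\<close>

text \<open>Embeddings are encoded first because sums of raw ones lose information. The last
  \<open>n + 1\<close> entries of the input are the aggregate; cutting them off leaves the own
  embedding, whatever the length of the label.\<close>

definition initial_layer :: "nat \<Rightarrow> layer" where
  "initial_layer n = \<lparr>agg = vec_sum (n + 1), com = (\<lambda>x. [enc (take (length x - (n + 1)) x)])\<rparr>"

definition refinement_layer :: layer where
  "refinement_layer = \<lparr>agg = vec_sum 1, com = (\<lambda>x. [enc x])\<rparr>"

text \<open>\<open>hd x\<close> is the node's own value. Combination functions are arbitrary, so any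
  set of reals may be tested.\<close>

definition decision_layer :: "real set \<Rightarrow> layer" where
  "decision_layer A = \<lparr>agg = vec_sum 1, com = (\<lambda>x. [of_bool (hd x \<in> A)])\<rparr>"

definition refinement_gnn :: "nat \<Rightarrow> nat \<Rightarrow> real set \<Rightarrow> gnn" where
  "refinement_gnn n k A =
    \<lparr>dims = (\<lambda>i. if i = 0 then n + 1 else 1),
     layers = initial_layer n # replicate k refinement_layer @ [decision_layer A]\<rparr>"

lemma nth_layers_refinement_gnn:
  assumes "i < length (layers (refinement_gnn n k A))"
  shows "i = 0 \<and> layers (refinement_gnn n k A) ! i = initial_layer n \<or>
    i \<noteq> 0 \<and> layers (refinement_gnn n k A) ! i \<in> {refinement_layer, decision_layer A}"
  using assms by (cases i) (auto simp: refinement_gnn_def nth_append)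

lemma local_sum_refinement_gnn: "local_sum (refinement_gnn n k A)"
  unfolding local_sum_def
proof (intro allI impI)
  fix i M
  assume "i < length (layers (refinement_gnn n k A))"
  from nth_layers_refinement_gnn[OF this]
  show "agg (layers (refinement_gnn n k A) ! i) M = vec_sum (dims (refinement_gnn n k A) i) M"
    by (auto simp: initial_layer_def refinement_layer_def decision_layer_def)
      (auto simp: refinement_gnn_def)
qed

lemma gnn_refinement_gnn: "gnn n (refinement_gnn n k A)"
proof -
  have "length (agg (layers (refinement_gnn n k A) ! i) M) = dims (refinement_gnn n k A) i"
    if "i < length (layers (refinement_gnn n k A))"
      "\<forall>x \<in># M. length x = dims (refinement_gnn n k A) i" for i M
    using local_sum_refinement_gnn that by (simp add: local_sum_def vec_sum_def)
  moreover have "length (com (layers (refinement_gnn n k A) ! i) x) =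
      dims (refinement_gnn n k A) (Suc i)"
    if "i < length (layers (refinement_gnn n k A))" for i x
    using nth_layers_refinement_gnn[OF that]
    by (auto simp: initial_layer_def refinement_layer_def decision_layer_def)
      (auto simp: refinement_gnn_def)
  ultimately show ?thesis
    unfolding gnn_def by (auto simp: refinement_gnn_def)
qed

lemma apply_initial_layer:
  "apply_layer G (initial_layer n) (initial_emb G key) = (\<lambda>v. [enc (colour G key 0 v)])"
  by (auto simp: apply_layer_def initial_layer_def initial_emb_def vec_sum_def)

text \<open>The own value followed by the aggregate is exactly the list that \<open>colour\<close>
  builds, so encoding it advances one round.\<close>

lemma apply_refinement_layer:
  "apply_layer G refinement_layer (\<lambda>v. [enc (colour G key i v)]) =
    (\<lambda>v. [enc (colour G key (Suc i) v)])"
  by (auto simp: apply_layer_def refinement_layer_def vec_sum_def sum_unfold_sum_mset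
      image_mset.compositionality comp_def)

lemma fold_refinement_layers:
  "fold (apply_layer G) (replicate k refinement_layer) (\<lambda>v. [enc (colour G key i v)]) =
    (\<lambda>v. [enc (colour G key (i + k) v)])"
  by (induction k arbitrary: i) (simp_all add: apply_refinement_layer del: colour.simps)

lemma apply_decision_layer:
  "apply_layer G (decision_layer A) (\<lambda>v. [f v]) u = [of_bool (f u \<in> A)]"
  by (simp add: apply_layer_def decision_layer_def)

lemma accepts_refinement_gnn:
  "accepts (refinement_gnn n k A) G key u \<longleftrightarrow> enc (colour G key k u) \<in> A"
  by (simp add: accepts_def gnn_output_def refinement_gnn_def apply_initial_layer
      fold_refinement_layers apply_decision_layer del: colour.simps fold_replicate)

theorem theorem5p10:
  fixes n :: nat and Q :: "('v lgraph \<times> 'v) set"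
  assumes "node_query n Q" and "strongly_local n Q"
  shows "\<exists>N. gnn n N \<and> local_sum N \<and> key_invariant TYPE('v) n N \<and> expressed_query n N = Q"
proof -
  from assms(2) obtain r
    where r: "(G, u) \<in> Q \<longleftrightarrow> (neighbourhood G u r, u) \<in> Q" if "(G, u) \<in> pointed_graphs n" for G u
    unfolding strongly_local_def by blast
  have Q: "P \<in> pointed_graphs n" if "P \<in> Q" for P
    using assms(1) that by (auto simp: node_query_def)
  have iso: "P' \<in> Q" if "P \<in> Q" "P' \<in> pointed_graphs n" "\<exists>f. pointed_iso f P P'" for P P'
    using assms(1) that unfolding node_query_def by blast
  \<comment> \<open>The codes that members of \<open>Q\<close> show at their distinguished nodes,
    over all injective keys.\<close>
  define A where "A = {enc (colour H key (Suc r) w) | H w key. (H, w) \<in> Q \<and> inj_on key (verts H)}"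
  define N where "N = refinement_gnn n (Suc r) A"
  have accepts: "accepts N G key u \<longleftrightarrow> (G, u) \<in> Q"
    if G: "(G, u) \<in> pointed_graphs n" and key: "keyed_extension G key"
    for G :: "'v lgraph" and u key
  proof
    assume "accepts N G key u"
    \<comment> \<open>Membership in \<open>A\<close> only yields some member of \<open>Q\<close>
      with the same colour. Its ball is in \<open>Q\<close> by locality, the isomorphism carries
      this to the ball of \<open>G\<close>, and locality leads back to \<open>G\<close>.\<close>
    then obtain H w key' where H: "(H, w) \<in> Q" "inj_on key' (verts H)"
      and eq: "colour H key' (Suc r) w = colour G key (Suc r) u"
      by (auto simp: N_def accepts_refinement_gnn A_def simp del: colour.simps)
    have "\<exists>f. pointed_iso f (neighbourhood H w r, w) (neighbourhood G u r, u)"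
      using pointed_iso_neighbourhood[OF Q[OF H(1)] H(2) G _ eq] key
      by (simp add: keyed_extension_def)
    moreover have "(neighbourhood H w r, w) \<in> Q"
      using H(1) r Q by blast
    ultimately have "(neighbourhood G u r, u) \<in> Q"
      using iso neighbourhood_pointed_graph[OF G] by blast
    then show "(G, u) \<in> Q"
      using r G by blast
  next
    assume "(G, u) \<in> Q"
    then show "accepts N G key u"
      using key unfolding N_def accepts_refinement_gnn A_def keyed_extension_def by blast
  qed
  \<comment> \<open>Without any keyed extension, \<open>expressed_query\<close> would contain
    \<open>(G, u)\<close> vacuously; numbering the finitely many nodes provides one.\<close>
  have ex_key: "\<exists>key. keyed_extension G key" if "(G, u) \<in> pointed_graphs n"
    for G :: "'v lgraph" and u
  proof -
    have "finite (verts G)"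
      using that by (simp add: pointed_graphs_def lgraph_def)
    then obtain h :: "'v \<Rightarrow> nat" where "inj_on h (verts G)"
      using finite_imp_inj_to_nat_seg by blast
    then have "keyed_extension G (\<lambda>v. real (h v))"
      by (simp add: keyed_extension_def inj_on_def)
    then show ?thesis
      by blast
  qed
  have "key_invariant TYPE('v) n N"
    using accepts unfolding key_invariant_def by blast
  moreover have "expressed_query n N = Q"
    using accepts ex_key Q unfolding expressed_query_def by blast
  ultimately show ?thesis
    using gnn_refinement_gnn local_sum_refinement_gnn N_def by blast
qed

end
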